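(* Let $n\ge k$ be integers with $4\le k\le\sqrt{2n-1}+1$. Then $$g(n,k)=2n-1-\left\lfloor\left(\frac{k-1}{2}\right)^2\right\rfloor.$$
   Context: $\mathbb{Z}_n=\mathbb{Z}/n\mathbb{Z}$. For positive integers $n,k$ with $k\le n$, $g(n,k)$ is the least integer $g\ge k$ such that every sequence in $\mathbb{Z}_n$ of length $g$ having at least $k$ distinct terms contains a subsequence of length $n$ whose sum is zero in $\mathbb{Z}_n$. *)

theory Defs
  imports Complex_Main "HOL-Library.Sublist" "HOL-Number_Theory.Cong"
begin

text \<open>The elements of \<open>\<int>/n\<int>\<close> are represented by the integers in \<open>{0..<int n}\<close>, so that
  distinct list entries are distinct residue classes.\<close>

definition residue_seq :: "nat \<Rightarrow> int list \<Rightarrow> bool" where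
  "residue_seq n xs \<longleftrightarrow> set xs \<subseteq> {0..<int n}"

definition has_zero_sum_subseq :: "nat \<Rightarrow> int list \<Rightarrow> bool" where
  "has_zero_sum_subseq n xs \<longleftrightarrow>
     (\<exists>ys. subseq ys xs \<and> length ys = n \<and> [sum_list ys = 0] (mod int n))"

text \<open>For \<open>1 \<le> k \<le> n\<close> the set of admissible lengths contains \<open>2 * n - 1\<close> by the
  Erdos-Ginzburg-Ziv theorem, so the minimum exists.\<close>

definition g :: "nat \<Rightarrow> nat \<Rightarrow> nat" where
  "g n k = (LEAST m. k \<le> m \<and>
     (\<forall>xs. residue_seq n xs \<and> length xs = m \<and> k \<le> card (set xs)
        \<longrightarrow> has_zero_sum_subseq n xs))"

end

theory Submission
  imports Defs "HOL-Library.Multiset"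
begin

text \<open>Call a sequence \<open>n\<close>-zero-free if no \<open>n\<close> of its terms sum to zero. The theorem of Savchev and
  Chen says that an \<open>n\<close>-zero-free sequence of length greater than \<open>3n/2 - 1\<close> is, up to an affine
  map, the union of positive integers \<open>a\<^sub>i\<close> and of terms \<open>1 - b\<^sub>j\<close> with positive integers \<open>b\<^sub>j\<close>,
  where \<open>\<Sum>a\<^sub>i < n\<close> and \<open>\<Sum>b\<^sub>j < n\<close>. With \<open>p\<close> distinct \<open>a\<^sub>i\<close> and \<open>q\<close> distinct \<open>b\<^sub>j\<close> the length is
  at most \<open>2n - 2 - p(p-1)/2 - q(q-1)/2\<close>; for \<open>p + q = k\<close> this is largest when \<open>p\<close> and \<open>q\<close> differ
  by at most one, and it is attained.

  For the structure theorem, translate so that \<open>0\<close> is a most frequent term, of multiplicity \<open>h\<close>.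
  By Scherk's addition theorem, \<open>n\<close> nonzero terms contain a zero-sum of length at most \<open>h\<close>; so a
  longest zero-sum subsequence \<open>U\<close> of the nonzero terms has length less than \<open>n - h\<close>, for a longer
  one could be cut down and filled up with zeros to length \<open>n\<close>. The remaining nonzero terms \<open>W\<close> are
  zero-sum free and number more than \<open>n/2\<close>, hence have few subsums and are, up to a unit,
  positive integers of sum less than \<open>n\<close>. Exchanging parts of \<open>U\<close> against longer
  subsequences of \<open>W\<close> of the same sum then determines \<open>U\<close>.\<close>

section \<open>Short zero-sum subsequences\<close>

text \<open>The induction replaces \<open>A, B\<close> by the Dyson transform \<open>A \<union> (e + B)\<close>, \<open>B \<inter> (A - e)\<close>.\<close>
lemma scherk_mod:
  fixes A B :: "int set"
  assumes n: "n > 0" and "A \<subseteq> {0..<int n}" "B \<subseteq> {0..<int n}" "0 \<in> A" "0 \<in> B"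
    and "\<And>a b. a \<in> A \<Longrightarrow> b \<in> B \<Longrightarrow> int n dvd a + b \<Longrightarrow> a = 0 \<and> b = 0"
  shows "card A + card B \<le> Suc (card {(a + b) mod int n |a b. a \<in> A \<and> b \<in> B})"
  using assms(2-)
proof (induction "card B" arbitrary: A B rule: less_induct)
  case less
  let ?N = "int n"
  let ?S = "\<lambda>A B. {(a + b) mod ?N |a b. a \<in> A \<and> b \<in> B}"
  note A = less.prems(1) and B = less.prems(2) and A0 = less.prems(3) and B0 = less.prems(4)
    and uniq = less.prems(5)
  have finA: "finite A" and finB: "finite B"
    using A B finite_subset by blast+
  have finS: "finite (?S A B)"
    by (rule finite_subset[of _ "{0..<?N}"]) (use n in auto)
  show ?case
  proof (cases "\<exists>e\<in>A. \<exists>b\<in>B. (e + b) mod ?N \<notin> A")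
    \<comment> \<open>Here \<open>A\<close> is stable under adding elements of \<open>B\<close>. A
      nonzero \<open>b\<close> would permute \<open>A\<close>, so some \<open>a\<close> would have
      \<open>a + b\<close> congruent to 0, against the uniqueness hypothesis.\<close>
    case False
    have "B = {0}"
    proof (rule ccontr)
      assume "B \<noteq> {0}"
      then obtain b where b: "b \<in> B" "b \<noteq> 0" using B0 by blast
      have inj: "inj_on (\<lambda>a. (a + b) mod ?N) A"
      proof (rule inj_onI)
        fix x y assume xy: "x \<in> A" "y \<in> A" "(x + b) mod ?N = (y + b) mod ?N"
        then have "x mod ?N = y mod ?N"
          using mod_diff_cong[OF xy(3) refl[of "b mod ?N"]] by simp
        then show "x = y" using xy A by (auto simp: subset_iff)
      qed
      have "(\<lambda>a. (a + b) mod ?N) ` A \<subseteq> A" using False b by auto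
      then have "(\<lambda>a. (a + b) mod ?N) ` A = A"
        using inj finA by (simp add: endo_inj_surj)
      then have "0 \<in> (\<lambda>a. (a + b) mod ?N) ` A" using A0 by simp
      then obtain a where "a \<in> A" "(a + b) mod ?N = 0" by force
      then show False using uniq[of a b] b by (simp add: dvd_eq_mod_eq_0)
    qed
    moreover have "A \<subseteq> ?S A B"
      using A B0 by (force simp: subset_iff)
    ultimately show ?thesis using card_mono[OF finS] by fastforce
  next
    case True
    then obtain e b0 where e: "e \<in> A" and b0: "b0 \<in> B" "(e + b0) mod ?N \<notin> A" by blast
    define f where "f = (\<lambda>b. (e + b) mod ?N)"
    define A' where "A' = A \<union> f ` B"
    define B' where "B' = {b \<in> B. f b \<in> A}"
    have inj: "inj_on f B"
    proof (rule inj_onI)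
      fix x y assume xy: "x \<in> B" "y \<in> B" "f x = f y"
      then have "x mod ?N = y mod ?N"
        using mod_diff_cong[of "e + x" ?N "e + y" e e] by (simp add: f_def)
      then show "x = y" using xy B by (auto simp: subset_iff)
    qed
    have "B' \<subset> B" using b0 by (auto simp: B'_def f_def)
    then have less': "card B' < card B" using finB psubset_card_mono by blast
    have "A \<inter> f ` B = f ` B'" by (auto simp: B'_def)
    then have "card (A \<inter> f ` B) = card B'"
      by (metis (no_types, lifting) B'_def card_image inj inj_on_subset mem_Collect_eq subsetI)
    then have card: "card A' + card B' = card A + card B"
      unfolding A'_def using card_Un_Int[OF finA, of "f ` B"] finB card_image[OF inj] by simp
    have A'sub: "A' \<subseteq> {0..<?N}" using A n by (auto simp: A'_def f_def)
    have "f 0 = e" using A e by (auto simp: f_def subset_iff)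
    then have B'0: "0 \<in> B'" using B0 e by (auto simp: B'_def)
    \<comment> \<open>For \<open>a = e + b1\<close> outside \<open>A\<close>, regroup
      \<open>a + b\<close> as \<open>(e + b) + b1\<close>, where \<open>e + b\<close> lies in
      \<open>A\<close> by the choice of \<open>B'\<close>. The same regrouping shows afterwards that
      the transform creates no new sums.\<close>
    have uniq': "a = 0 \<and> b = 0" if ab: "a \<in> A'" "b \<in> B'" "?N dvd a + b" for a b
    proof (cases "a \<in> A")
      case True
      then show ?thesis using uniq that by (auto simp: B'_def)
    next
      case False
      then obtain b1 where b1: "b1 \<in> B" "a = f b1" using ab by (auto simp: A'_def)
      have b: "b \<in> B" "f b \<in> A" using ab by (auto simp: B'_def)
      have "(f b + b1) mod ?N = (f b1 + b) mod ?N" by (simp add: f_def mod_simps add_ac)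
      then have "?N dvd f b + b1" using ab b1 by (simp add: dvd_eq_mod_eq_0)
      then have z: "f b = 0" "b1 = 0" using uniq b b1 by auto
      then have "?N dvd e + b" by (simp add: f_def dvd_eq_mod_eq_0)
      then have "e = 0" using uniq e b by blast
      then show ?thesis using z b1 False A0 by (simp add: f_def)
    qed
    have "?S A' B' \<subseteq> ?S A B"
    proof clarify
      fix a b assume ab: "a \<in> A'" "b \<in> B'"
      have b: "b \<in> B" "f b \<in> A" using ab by (auto simp: B'_def)
      show "\<exists>a' b'. (a + b) mod ?N = (a' + b') mod ?N \<and> a' \<in> A \<and> b' \<in> B"
      proof (cases "a \<in> A")
        case False
        then obtain b1 where b1: "b1 \<in> B" "a = f b1" using ab by (auto simp: A'_def)
        have "(a + b) mod ?N = (f b + b1) mod ?N" using b1 by (simp add: f_def mod_simps add_ac)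
        then show ?thesis using b b1 by blast
      qed (use b in blast)
    qed
    then have "card (?S A' B') \<le> card (?S A B)" using finS card_mono by blast
    moreover have "card A' + card B' \<le> Suc (card (?S A' B'))"
      using less.hyps[OF less' A'sub _ _ B'0 uniq'] A0 B by (auto simp: A'_def B'_def)
    ultimately show ?thesis using card by simp
  qed
qed

text \<open>Induction on \<open>h\<close>, removing one copy of every distinct term. By Scherk's
  theorem, adding these terms (or 0) to the sums of at most \<open>h\<close> remaining terms gains
  at least as many sums as there are distinct terms; the absence of short zero-sums is its
  uniqueness hypothesis.\<close>

lemma short_zero_sum_aux:
  assumes n: "n > 0" and "set_mset S \<subseteq> {1..<int n}" and "\<And>x. count S x \<le> h"
    and "\<And>U. U \<subseteq># S \<Longrightarrow> U \<noteq> {#} \<Longrightarrow> size U \<le> h \<Longrightarrow> \<not> int n dvd \<Sum>\<^sub># U"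
  shows "size S < card ((\<lambda>U. \<Sum>\<^sub># U mod int n) ` {U. U \<subseteq># S \<and> size U \<le> h})"
  using assms(2-)
proof (induction h arbitrary: S)
  case 0
  then have "S = {#}" by (simp add: multiset_eq_iff)
  then show ?case by simp
next
  case (Suc h)
  let ?N = "int n"
  let ?X = "\<lambda>S h. (\<lambda>U. \<Sum>\<^sub># U mod ?N) ` {U. U \<subseteq># S \<and> size U \<le> h}"
  define D where "D = mset_set (set_mset S)"
  have D: "D \<subseteq># S" by (simp add: D_def mset_set_set_mset_msubset)
  have sub: "S - D \<subseteq># S" by simp
  have cnt: "count (S - D) x \<le> h" for x
    using Suc.prems(2)[of x] by (cases "x \<in># S") (auto simp: D_def not_in_iff)
  have IH: "size (S - D) < card (?X (S - D) h)"
  proof (rule Suc.IH)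
    show "set_mset (S - D) \<subseteq> {1..<?N}" using Suc.prems(1) in_diffD by fastforce
    show "\<not> ?N dvd \<Sum>\<^sub># U" if "U \<subseteq># S - D" "U \<noteq> {#}" "size U \<le> h" for U
      using Suc.prems(3)[of U] that subset_mset.trans[OF that(1) sub] by simp
  qed (fact cnt)
  define B where "B = insert 0 (set_mset S)"
  have B0: "0 \<in> B" and cB: "card B = Suc (size D)"
    using Suc.prems(1) by (auto simp: B_def D_def card_insert_if)
  \<comment> \<open>The copy of \<open>b\<close> kept in \<open>D\<close> is still available, even
    if \<open>V\<close> uses all copies of \<open>b\<close> in \<open>S - D\<close>.\<close>
  have ext: "V + {#b#} \<subseteq># S" if "V \<subseteq># S - D" "b \<in># S" for V b
  proof -
    have "{#b#} \<subseteq># D" using that by (simp add: D_def)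
    then have "V + {#b#} \<subseteq># (S - D) + D" using that by (intro subset_mset.add_mono)
    then show ?thesis using D by simp
  qed
  have "card (?X (S - D) h) + card B \<le>
      Suc (card {(a + b) mod ?N |a b. a \<in> ?X (S - D) h \<and> b \<in> B})"
  proof (rule scherk_mod[OF n])
    show "?X (S - D) h \<subseteq> {0..<?N}" using n by auto
    show "B \<subseteq> {0..<?N}" using Suc.prems(1) n by (auto simp: B_def)
    show "0 \<in> ?X (S - D) h" by (rule image_eqI[of _ _ "{#}"]) auto
    show "0 \<in> B" by (fact B0)
    fix a b assume a: "a \<in> ?X (S - D) h" and b: "b \<in> B" and dvd: "?N dvd a + b"
    obtain V where V: "V \<subseteq># S - D" "size V \<le> h" "a = \<Sum>\<^sub># V mod ?N" using a by auto
    show "a = 0 \<and> b = 0"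
    proof (cases "b = 0")
      case True
      then have "?N dvd \<Sum>\<^sub># V" using dvd V by (simp add: dvd_mod_iff)
      then have "V = {#}"
        using Suc.prems(3)[of V] V sub by (meson le_Suc_eq subset_mset.trans)
      then show ?thesis using V True by simp
    next
      case False
      then have bS: "b \<in># S" using b by (auto simp: B_def)
      have "?N dvd \<Sum>\<^sub># (V + {#b#})" using dvd V by (simp add: dvd_eq_mod_eq_0 mod_simps add_ac)
      then show ?thesis using Suc.prems(3)[OF ext[OF V(1) bS]] V by simp
    qed
  qed
  moreover have "{(a + b) mod ?N |a b. a \<in> ?X (S - D) h \<and> b \<in> B} \<subseteq> ?X S (Suc h)"
  proof clarify
    fix b V assume b: "b \<in> B" and V: "V \<subseteq># S - D" "size V \<le> h"
    show "(\<Sum>\<^sub># V mod ?N + b) mod ?N \<in> ?X S (Suc h)"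
    proof (cases "b = 0")
      case True
      then show ?thesis using V subset_mset.trans[OF V(1) sub]
        by (intro image_eqI[of _ _ V]) auto
    next
      case False
      then have bS: "b \<in># S" using b by (auto simp: B_def)
      show ?thesis using ext[OF V(1) bS] V
        by (intro image_eqI[of _ _ "V + {#b#}"]) (auto simp: mod_simps add_ac)
    qed
  qed
  then have "card {(a + b) mod ?N |a b. a \<in> ?X (S - D) h \<and> b \<in> B} \<le> card (?X S (Suc h))"
    by (rule card_mono[rotated]) (rule finite_subset[of _ "{0..<?N}"], use n in auto)
  moreover have "size S = size (S - D) + size D" using D
    by (metis size_union subset_mset.diff_add)
  ultimately show ?case using IH cB by linarith
qed

text \<open>Pigeonhole: without such a \<open>U\<close> there would be more than \<open>n\<close>
  residues modulo \<open>n\<close>.\<close>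

lemma short_zero_sum:
  assumes n: "n > 0" and S: "set_mset S \<subseteq> {1..<int n}" "\<And>x. count S x \<le> h" and "n \<le> size S"
  obtains U where "U \<subseteq># S" "U \<noteq> {#}" "size U \<le> h" "int n dvd \<Sum>\<^sub># U"
proof (rule ccontr)
  assume "\<not> thesis"
  then have "size S < card ((\<lambda>U. \<Sum>\<^sub># U mod int n) ` {U. U \<subseteq># S \<and> size U \<le> h})"
    using that by (intro short_zero_sum_aux[OF n S]) blast+
  also have "\<dots> \<le> card {0..<int n}"
    by (rule card_mono) (use n in auto)
  finally show False using assms(4) by simp
qed

section \<open>Zero-sum free sequences with few subsums\<close>

definition zero_sum_free :: "nat \<Rightarrow> int multiset \<Rightarrow> bool" where
  "zero_sum_free n S \<longleftrightarrow> (\<forall>U. U \<subseteq># S \<and> U \<noteq> {#} \<longrightarrow> \<not> int n dvd \<Sum>\<^sub># U)"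

definition subsums :: "nat \<Rightarrow> int multiset \<Rightarrow> int set" where
  "subsums n S = (\<lambda>U. \<Sum>\<^sub># U mod int n) ` {U. U \<subseteq># S}"


lemma subset_add_mset_cases:
  assumes "U \<subseteq># add_mset x S"
  obtains "U \<subseteq># S" | V where "U = add_mset x V" "V \<subseteq># S"
proof (cases "x \<in># U")
  case True
  then have "U = add_mset x (U - {#x#})" by simp
  moreover have "U - {#x#} \<subseteq># S" using assms by (simp add: subset_eq_diff_conv)
  ultimately show ?thesis using that by blast
next
  case False
  then have "U \<subseteq># S" using assms
    by (metis diff_single_trivial subset_eq_diff_conv add_mset_add_single)
  then show ?thesis using that by blast
qed

lemma subsums_add_mset:
  "subsums n (add_mset x S) = subsums n S \<union> (\<lambda>s. (s + x) mod int n) ` subsums n S"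
proof -
  have "{U. U \<subseteq># add_mset x S} = {U. U \<subseteq># S} \<union> add_mset x ` {U. U \<subseteq># S}"
    by (auto elim: subset_add_mset_cases intro: subset_mset.order_trans[of _ S])
  then show ?thesis
    by (simp add: subsums_def image_Un image_image mod_simps add.commute)
qed

lemma zero_in_subsums: "0 \<in> subsums n S"
  unfolding subsums_def by (rule image_eqI[of _ _ "{#}"]) auto

lemma subsums_bounds: "n > 0 \<Longrightarrow> subsums n S \<subseteq> {0..<int n}"
  by (auto simp: subsums_def)

lemma finite_subsums: "n > 0 \<Longrightarrow> finite (subsums n S)"
  using subsums_bounds finite_subset by blast

lemma zero_sum_free_mono: "zero_sum_free n S \<Longrightarrow> U \<subseteq># S \<Longrightarrow> zero_sum_free n U"
  unfolding zero_sum_free_def by (meson subset_mset.order_trans)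

lemma zero_sum_free_add_mset:
  assumes "zero_sum_free n (add_mset x S)" "s \<in> subsums n S"
  shows "\<not> int n dvd s + x"
proof -
  obtain U where U: "U \<subseteq># S" "s = \<Sum>\<^sub># U mod int n" using assms by (auto simp: subsums_def)
  have "\<not> int n dvd \<Sum>\<^sub># (add_mset x U)"
    using assms(1) U unfolding zero_sum_free_def by (metis add_mset_not_empty mset_subset_eq_add_mset_cancel)
  then show ?thesis using U by (simp add: dvd_eq_mod_eq_0 mod_simps add.commute)
qed

text \<open>If a part \<open>U\<close> of \<open>S\<close> had the total sum, its complement,
  nonempty because it contains \<open>x\<close>, would sum to zero.\<close>

lemma total_notin_subsums:
  assumes "zero_sum_free n (add_mset x S)"
  shows "\<Sum>\<^sub># (add_mset x S) mod int n \<notin> subsums n S"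
proof
  assume "\<Sum>\<^sub># (add_mset x S) mod int n \<in> subsums n S"
  then obtain U where U: "U \<subseteq># S" "\<Sum>\<^sub># (add_mset x S) mod int n = \<Sum>\<^sub># U mod int n"
    by (auto simp: subsums_def)
  have "add_mset x (S - U) \<subseteq># add_mset x S" by simp
  moreover have "int n dvd \<Sum>\<^sub># (add_mset x (S - U))"
    using U by (simp add: sum_mset_diff mod_eq_dvd_iff add_diff_eq)
  ultimately show False using assms unfolding zero_sum_free_def by (metis add_mset_not_empty)
qed

text \<open>Savchev and Chen. If deleting some term shrinks the set of subsums by at least two, induct.
  Otherwise translation by any term maps \<open>B - {\<sigma>}\<close> onto \<open>B - {0}\<close>, where \<open>B\<close> is the set of
  subsums and \<open>\<sigma>\<close> the total sum; two distinct terms would make their difference a period.\<close>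
lemma zero_sum_free_structure:
  assumes n: "n > 0" and "set_mset S \<subseteq> {0..<int n}" "zero_sum_free n S"
    and "card (subsums n S) < 2 * size S"
  shows "\<exists>g T. (\<forall>t\<in>#T. 1 \<le> t) \<and> S = image_mset (\<lambda>t. g * t mod int n) T \<and>
    subsums n S = (\<lambda>i. g * i mod int n) ` {0..\<Sum>\<^sub># T} \<and> (\<forall>i\<in>{1..\<Sum>\<^sub># T}. \<not> int n dvd g * i)"
  using assms(2-)
proof (induction "size S" arbitrary: S rule: less_induct)
  case less
  let ?N = "int n"
  note S = less.prems(1) and free = less.prems(2) and small = less.prems(3)
  show ?case
  proof (cases "\<exists>x\<in>#S. card (subsums n (S - {#x#})) + 2 \<le> card (subsums n S)")
    case True
    then obtain x where x: "x \<in># S" "card (subsums n (S - {#x#})) + 2 \<le> card (subsums n S)"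
      by blast
    define S' where "S' = S - {#x#}"
    have S': "S = add_mset x S'" using x by (simp add: S'_def)
    have free': "zero_sum_free n S'" using free by (rule zero_sum_free_mono) (simp add: S')
    \<comment> \<open>Losing one term and at least two subsums preserves the inequality needed for
      the induction.\<close>
    have "card (subsums n S') < 2 * size S'" using x small by (simp add: S'_def size_Diff_singleton)
    then obtain g T where T: "\<forall>t\<in>#T. 1 \<le> t" "S' = image_mset (\<lambda>t. g * t mod ?N) T"
      and sums: "subsums n S' = (\<lambda>i. g * i mod ?N) ` {0..\<Sum>\<^sub># T}"
      and nz: "\<forall>i\<in>{1..\<Sum>\<^sub># T}. \<not> ?N dvd g * i"
      using less.hyps[of S'] S S' free' by auto
    define s where "s = \<Sum>\<^sub># T"
    have "size T \<le> s"
      unfolding s_def using T(1) by (induction T) auto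
    then have sz: "size S' \<le> s" using T(2) by simp
    have x: "0 \<le> x" "x < ?N" using S S' by auto
    have notzero: "\<not> ?N dvd g * i + x" if "i \<in> {0..s}" for i
    proof -
      have "g * i mod ?N \<in> subsums n S'" using that sums by (auto simp: s_def)
      then have "\<not> ?N dvd g * i mod ?N + x" using zero_sum_free_add_mset free S' by blast
      then show ?thesis by (simp add: dvd_eq_mod_eq_0 mod_simps)
    qed
    have sumsS: "subsums n S = (\<lambda>i. g * i mod ?N) ` {0..s} \<union> (\<lambda>i. (g * i + x) mod ?N) ` {0..s}"
      by (simp add: S' subsums_add_mset sums s_def image_image mod_simps)
    show ?thesis
    proof (cases "\<exists>t\<in>{1..s}. x = g * t mod ?N")
      \<comment> \<open>The intervals \<open>{0..s}\<close> and \<open>{t..s + t}\<close> meet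
        because \<open>t \<le> s\<close>, so the subsums of \<open>S\<close> are again a progression
        and \<open>x\<close> joins \<open>T\<close> as \<open>t\<close>.\<close>
      case True
      then obtain t where t: "1 \<le> t" "t \<le> s" "x = g * t mod ?N" by auto
      have "(\<lambda>i. (g * i + x) mod ?N) ` {0..s} = (\<lambda>i. g * (i + t) mod ?N) ` {0..s}"
        by (simp add: t mod_simps algebra_simps)
      also have "\<dots> = (\<lambda>i. g * i mod ?N) ` ((\<lambda>i. i + t) ` {0..s})" by (simp only: image_image)
      also have "(\<lambda>i. i + t) ` {0..s} = {t..s + t}" by (simp add: add.commute)
      finally have "subsums n S = (\<lambda>i. g * i mod ?N) ` ({0..s} \<union> {t..s + t})"
        using sumsS by (simp add: image_Un)
      also have "{0..s} \<union> {t..s + t} = {0..s + t}" using t by auto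
      finally have 1: "subsums n S = (\<lambda>i. g * i mod ?N) ` {0..\<Sum>\<^sub># (add_mset t T)}"
        by (simp add: s_def add.commute)
      have "\<not> ?N dvd g * i" if "i \<in> {1..\<Sum>\<^sub># (add_mset t T)}" for i
      proof (cases "i \<le> s")
        case True
        then show ?thesis using nz that by (auto simp: s_def)
      next
        case False
        then have "\<not> ?N dvd g * (i - t) + x" using that t by (intro notzero) (auto simp: s_def)
        moreover have "(g * (i - t) + x) mod ?N = g * i mod ?N"
          unfolding t(3) mod_add_right_eq by (simp add: algebra_simps)
        ultimately show ?thesis by (simp add: dvd_eq_mod_eq_0)
      qed
      then show ?thesis using T t S' 1 by (intro exI[of _ g] exI[of _ "add_mset t T"]) auto
    next
      \<comment> \<open>Otherwise the progression and its translate by \<open>x\<close> are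
        disjoint, giving \<open>2 * (s + 1)\<close> subsums with \<open>s + 1 \<ge> size S\<close>,
        against the assumed bound.\<close>
      case False
      have inj: "i = j" if "i \<in> {0..s}" "j \<in> {0..s}" "g * i mod ?N = g * j mod ?N" for i j
      proof -
        have dvd: "?N dvd g * (i - j)" "?N dvd g * (j - i)"
          using that(3) mod_eq_dvd_iff[of "g * i" ?N "g * j"] mod_eq_dvd_iff[of "g * j" ?N "g * i"]
          by (simp_all add: algebra_simps)
        show ?thesis
        proof (rule linorder_cases[of i j])
          assume "i < j"
          then show ?thesis using nz[rule_format, of "j - i"] dvd that by (auto simp: s_def)
        next
          assume "j < i"
          then show ?thesis using nz[rule_format, of "i - j"] dvd that by (auto simp: s_def)
        qed
      qed
      have disj: "g * i mod ?N \<noteq> (g * j + x) mod ?N" if "i \<in> {0..s}" "j \<in> {0..s}" for i j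
      proof
        assume eq: "g * i mod ?N = (g * j + x) mod ?N"
        show False
        proof (cases "i \<le> j")
          case True
          have "?N dvd g * (j - i) + x"
            using mod_eq_dvd_iff[of "g * j + x" ?N "g * i"] eq by (simp add: algebra_simps)
          then show False using notzero[of "j - i"] that True by auto
        next
          case lt: False
          have "?N dvd g * (i - j) - x"
            using mod_eq_dvd_iff[of "g * i" ?N "g * j + x"] eq by (simp add: algebra_simps)
          then have "x = g * (i - j) mod ?N" using x by (metis mod_eq_dvd_iff mod_pos_pos_trivial)
          then show False using False lt that by auto
        qed
      qed
      have "inj_on (\<lambda>i. g * i mod ?N) {0..s}" using inj by (auto intro: inj_onI)
      moreover have "inj_on (\<lambda>i. (g * i + x) mod ?N) {0..s}"
      proof (rule inj_onI)
        fix i j assume ij: "i \<in> {0..s}" "j \<in> {0..s}" "(g * i + x) mod ?N = (g * j + x) mod ?N"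
        then have "g * i mod ?N = g * j mod ?N" by (metis mod_eq_dvd_iff add_diff_cancel_right)
        then show "i = j" using inj ij by blast
      qed
      moreover have "(\<lambda>i. g * i mod ?N) ` {0..s} \<inter> (\<lambda>i. (g * i + x) mod ?N) ` {0..s} = {}"
        using disj by blast
      ultimately have "card (subsums n S) = 2 * nat (s + 1)"
        unfolding sumsS by (simp add: card_Un_disjoint card_image)
      then show ?thesis using small S' sz by auto
    qed
  next
    case False
    define B where "B = subsums n S"
    define \<sigma> where "\<sigma> = \<Sum>\<^sub># S mod ?N"
    have finB: "finite B" using n by (simp add: B_def finite_subsums)
    obtain g where g: "g \<in># S" using small by (metis multiset_nonemptyE size_empty mult_0_right not_less0)
    have B0: "0 \<in> B" by (simp add: B_def zero_in_subsums)
    have \<sigma>0: "\<sigma> \<noteq> 0" using free g by (auto simp: \<sigma>_def zero_sum_free_def dvd_eq_mod_eq_0)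
    have \<sigma>B: "\<sigma> \<in> B" by (auto simp: B_def \<sigma>_def subsums_def)
    \<comment> \<open>Deleting \<open>x\<close> loses only the total sum \<open>\<sigma>\<close>, so
      the subsums of the rest are \<open>B - {\<sigma>}\<close>; adding \<open>x\<close> to them
      stays in \<open>B\<close> and avoids 0, and the cardinalities agree.\<close>
    have shift: "(\<lambda>a. (a + x) mod ?N) ` (B - {\<sigma>}) = B - {0}" if x: "x \<in># S" for x
    proof -
      define S' where "S' = S - {#x#}"
      have S': "S = add_mset x S'" using x by (simp add: S'_def)
      let ?A = "subsums n S'"
      have B: "B = ?A \<union> (\<lambda>s. (s + x) mod ?N) ` ?A" by (simp add: B_def S' subsums_add_mset)
      have "\<sigma> \<notin> ?A" using total_notin_subsums free S' by (simp add: \<sigma>_def)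
      then have sub: "?A \<subseteq> B - {\<sigma>}" using B by blast
      have "\<not> card ?A + 2 \<le> card B" using False x by (auto simp: B_def S'_def)
      then have "card (B - {\<sigma>}) \<le> card ?A" using finB \<sigma>B by simp
      then have A: "?A = B - {\<sigma>}" using sub finB by (intro card_seteq) auto
      have inj: "inj_on (\<lambda>a. (a + x) mod ?N) ?A"
      proof (rule inj_onI)
        fix a b assume ab: "a \<in> ?A" "b \<in> ?A" "(a + x) mod ?N = (b + x) mod ?N"
        then have "a mod ?N = b mod ?N" by (metis mod_eq_dvd_iff add_diff_cancel_right)
        then show "a = b" using ab subsums_bounds[OF n, of S'] by (auto simp: subset_iff)
      qed
      have "0 \<notin> (\<lambda>a. (a + x) mod ?N) ` ?A"
        using zero_sum_free_add_mset[of n x S'] free S' by (auto simp: dvd_eq_mod_eq_0)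
      then have "(\<lambda>a. (a + x) mod ?N) ` ?A \<subseteq> B - {0}" using B by blast
      moreover have "card (B - {0}) = card ((\<lambda>a. (a + x) mod ?N) ` ?A)"
        using inj A finB \<sigma>B B0 by (simp add: card_image)
      ultimately show ?thesis using finB unfolding A[symmetric] by (intro card_seteq) auto
    qed
    have all_eq: "x = g" if x: "x \<in># S" for x
    proof (rule ccontr)
      assume "x \<noteq> g"
      define d where "d = (x - g) mod ?N"
      have "x mod ?N \<noteq> g mod ?N" using \<open>x \<noteq> g\<close> x g S by (auto simp: subset_iff)
      then have "d \<noteq> 0" unfolding d_def using mod_eq_dvd_iff[of x ?N g] by auto
      \<comment> \<open>Shifting 0 by \<open>x\<close> and undoing the shift by \<open>g\<close>
        puts \<open>d\<close> into \<open>B - {\<sigma>}\<close>. As \<open>d\<close> is nonzero, it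
        is \<open>b + x\<close> with \<open>b\<close> in \<open>B - {\<sigma>}\<close>; then
        \<open>b + g\<close> is zero, which the shift by \<open>g\<close> excludes.\<close>
      have "(0 + x) mod ?N \<in> (\<lambda>a. (a + g) mod ?N) ` (B - {\<sigma>})"
        using shift[OF x] shift[OF g] B0 \<sigma>0 by blast
      then obtain a where a: "a \<in> B - {\<sigma>}" "x mod ?N = (a + g) mod ?N" by auto
      have "a = d"
        using a subsums_bounds[OF n, of S] mod_eq_dvd_iff[of x ?N "a + g"]
          mod_eq_dvd_iff[of "x - g" ?N a] by (auto simp: d_def B_def algebra_simps subset_iff)
      then have "d \<in> (\<lambda>a. (a + x) mod ?N) ` (B - {\<sigma>})"
        using a \<open>d \<noteq> 0\<close> shift[OF x] by blast
      then obtain b where b: "b \<in> B - {\<sigma>}" "d = (b + x) mod ?N" by blast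
      have "(b + g) mod ?N = (d - (x - g)) mod ?N"
        unfolding b(2) mod_diff_left_eq by (simp add: algebra_simps)
      also have "\<dots> = 0" unfolding d_def mod_diff_left_eq by simp
      finally have "(b + g) mod ?N = 0" .
      moreover have "(b + g) mod ?N \<in> B - {0}" unfolding shift[OF g, symmetric] using b(1) by (rule imageI)
      ultimately show False by simp
    qed
    define l where "l = size S"
    have Sl: "S = replicate_mset l g"
      unfolding l_def using all_eq by (induction S) auto
    have gm: "g mod ?N = g" using g S by auto
    have sums: "subsums n S = (\<lambda>i. g * i mod ?N) ` {0..int l}"
    proof -
      have "{U. U \<subseteq># S} = (\<lambda>j. replicate_mset j g) ` {0..l}"
        by (auto simp: Sl replicate_mset_msubseteq_iff elim: msubseteq_replicate_msetE)
      then have "subsums n S = (\<lambda>j. g * int j mod ?N) ` {0..l}"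
        by (simp add: subsums_def image_image mult.commute)
      also have "\<dots> = (\<lambda>i. g * i mod ?N) ` (int ` {0..l})" by (simp only: image_image)
      finally show ?thesis by (simp add: image_int_atLeastAtMost)
    qed
    have "\<not> ?N dvd g * i" if "i \<in> {1..int l}" for i
    proof -
      have "replicate_mset (nat i) g \<subseteq># S" "replicate_mset (nat i) g \<noteq> {#}"
        using that by (auto simp: Sl replicate_mset_msubseteq_iff)
      then have "\<not> ?N dvd \<Sum>\<^sub># (replicate_mset (nat i) g)"
        using free unfolding zero_sum_free_def by blast
      then show ?thesis using that by (simp add: mult.commute)
    qed
    then show ?thesis using sums gm
      by (intro exI[of _ g] exI[of _ "replicate_mset l 1"]) (auto simp: Sl)
  qed
qed

section \<open>Exchange with a longest zero-sum subsequence\<close>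

lemma sum_mset_nonneg_int: "\<forall>q\<in>#Q. 0 \<le> q \<Longrightarrow> (0::int) \<le> \<Sum>\<^sub># Q"
  by (induction Q) auto

lemma size_le_sum_mset: "\<forall>t\<in>#W. 1 \<le> t \<Longrightarrow> int (size W) \<le> \<Sum>\<^sub># W"
  by (induction W) auto

lemma double_size_le_sum_mset:
  "\<forall>t\<in>#W. 1 \<le> t \<Longrightarrow> 2 * int (size W) \<le> \<Sum>\<^sub># W + int (count W 1)"
  by (induction W) auto

text \<open>All terms other than 1 are at least 2, so a large term must be paid for by many ones:
  apply the doubled bound to the multiset without \<open>t\<close>.\<close>

lemma term_le_count_one:
  fixes t :: int
  assumes "\<forall>t\<in>#W. 1 \<le> t" "\<Sum>\<^sub># W + 2 \<le> 2 * int (size W)" "t \<in># W"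
  shows "t \<le> int (count W 1)"
proof (cases "t = 1")
  case True
  then show ?thesis using assms(3) by (simp add: Suc_leI)
next
  case False
  obtain W' where W': "W = add_mset t W'" using multi_member_split[OF assms(3)] by blast
  show ?thesis
    using double_size_le_sum_mset[of W'] assms False by (auto simp: W')
qed

text \<open>The \<open>v\<close> ones cover \<open>{0..v}\<close>; every other term is at most
  \<open>v\<close>, so adding it extends the covered interval without a gap.\<close>

lemma all_subsums:
  fixes c :: int
  assumes "\<forall>t\<in>#W. 1 \<le> t" "\<Sum>\<^sub># W + 2 \<le> 2 * int (size W)" "0 \<le> c" "c \<le> \<Sum>\<^sub># W"
  obtains V where "V \<subseteq># W" "\<Sum>\<^sub># V = c"
proof -
  define v where "v = count W 1"
  have gen: "\<exists>V. V \<subseteq># replicate_mset v 1 + Q \<and> \<Sum>\<^sub># V = c"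
    if "\<forall>q\<in>#Q. q \<le> int v + 1" "\<forall>q\<in>#Q. 0 \<le> q" "0 \<le> c" "c \<le> int v + \<Sum>\<^sub># Q" for Q c
    using that
  proof (induction Q arbitrary: c)
    case empty
    then show ?case
      by (intro exI[of _ "replicate_mset (nat c) 1"]) (auto simp: replicate_mset_msubseteq_iff)
  next
    case (add q Q)
    have Q0: "0 \<le> \<Sum>\<^sub># Q" using add.prems(2) by (intro sum_mset_nonneg_int) auto
    show ?case
    proof (cases "c \<le> int v + \<Sum>\<^sub># Q")
      case True
      then obtain V where V: "V \<subseteq># replicate_mset v 1 + Q" "\<Sum>\<^sub># V = c"
        using add.IH[of c] add.prems by auto
      then have "V \<subseteq># replicate_mset v 1 + add_mset q Q"
        by (simp add: subset_mset.order_trans[OF V(1)])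
      then show ?thesis using V by blast
    next
      case False
      then obtain V where V: "V \<subseteq># replicate_mset v 1 + Q" "\<Sum>\<^sub># V = c - q"
        using add.IH[of "c - q"] add.prems Q0 by force
      then have "add_mset q V \<subseteq># replicate_mset v 1 + add_mset q Q" by simp
      then show ?thesis using V(2) by (intro exI[of _ "add_mset q V"]) auto
    qed
  qed
  have W: "W = replicate_mset v 1 + filter_mset (\<lambda>t. t \<noteq> 1) W"
    using multiset_partition[of W "\<lambda>t. t = 1"] by (simp add: v_def filter_eq_replicate_mset)
  have "\<Sum>\<^sub># W = int v + \<Sum>\<^sub># (filter_mset (\<lambda>t. t \<noteq> 1) W)"
    by (subst W) simp
  then have "\<exists>V. V \<subseteq># replicate_mset v 1 + filter_mset (\<lambda>t. t \<noteq> 1) W \<and> \<Sum>\<^sub># V = c"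
    using assms term_le_count_one[OF assms(1,2)] by (intro gen) (force simp: v_def)+
  then show ?thesis using that W by metis
qed

text \<open>A representation by the single term \<open>y\<close> can be replaced by \<open>y\<close>
  ones, since no term exceeds the number of ones. This serves to exchange one term for
  several.\<close>

lemma long_subsum:
  fixes y :: int
  assumes "\<forall>t\<in>#W. 1 \<le> t" "\<Sum>\<^sub># W + 2 \<le> 2 * int (size W)" "2 \<le> y" "y \<le> \<Sum>\<^sub># W"
  obtains V where "V \<subseteq># W" "\<Sum>\<^sub># V = y" "2 \<le> size V"
proof -
  obtain V where V: "V \<subseteq># W" "\<Sum>\<^sub># V = y" using all_subsums[OF assms(1,2), of y] assms by auto
  show ?thesis
  proof (cases "2 \<le> size V")
    case True
    then show ?thesis using V that by blast
  next
    case False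
    then have "size V = 0 \<or> size V = Suc 0" by linarith
    then have "V = {#y#}" using V assms(3) size_1_singleton_mset[of V] by auto
    then have "y \<in># W" using V(1) by (auto simp: insert_subset_eq_iff)
    then have "nat y \<le> count W 1" using term_le_count_one[OF assms(1,2)] by (simp add: nat_le_iff)
    then have "replicate_mset (nat y) 1 \<subseteq># W" by (simp add: count_le_replicate_mset_subset_eq)
    then show ?thesis using assms(3) by (intro that[of "replicate_mset (nat y) 1"]) auto
  qed
qed

text \<open>Take \<open>X\<close> with the fewest terms. Without its least term \<open>z\<close> the
  sum is at most \<open>N\<close>, and the terms left are all at least \<open>z\<close>, so
  \<open>size X' * z \<le> N\<close>; a product of two positive integers is at least their sum minus
  one.\<close>

lemma minimal_overflow:
  fixes N :: int
  assumes "0 \<le> N" "\<forall>z\<in>#Z. 1 \<le> z \<and> z \<le> N" "N < \<Sum>\<^sub># Z"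
  obtains X where "X \<subseteq># Z" "N < \<Sum>\<^sub># X" "int (size X) + \<Sum>\<^sub># X \<le> 2 * N + 2" "X \<noteq> {#}"
proof -
  obtain X where X: "X \<subseteq># Z" "N < \<Sum>\<^sub># X"
    and min: "\<And>Y. Y \<subseteq># Z \<Longrightarrow> N < \<Sum>\<^sub># Y \<Longrightarrow> size X \<le> size Y"
    using ex_has_least_nat[of "\<lambda>X. X \<subseteq># Z \<and> N < \<Sum>\<^sub># X" Z size] assms(3) by auto
  have ne: "X \<noteq> {#}" using X assms(1) by auto
  define z where "z = Min (set_mset X)"
  have z: "z \<in># X" using ne by (simp add: z_def)
  obtain X' where X': "X = add_mset z X'" using multi_member_split[OF z] by blast
  have "z \<in># Z" using X(1) z by (rule mset_subset_eqD)
  then have zb: "1 \<le> z" "z \<le> N" using assms(2) by auto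
  have "X' \<subseteq># Z" using X(1) subset_mset.order_trans[of X' X Z] by (simp add: X')
  then have "\<not> N < \<Sum>\<^sub># X'" using min[of X'] by (auto simp: X')
  then have le: "\<Sum>\<^sub># X' \<le> N" by simp
  have "\<forall>x\<in>#X. z \<le> x" by (simp add: z_def)
  then have "\<forall>x\<in>#X'. z \<le> x" by (simp add: X')
  then have "int (size X') * z \<le> \<Sum>\<^sub># X'"
    by (induction X') (auto simp: algebra_simps)
  then have "int (size X') * z \<le> N" using le by linarith
  moreover have "int (size X') + z \<le> int (size X') * z + 1 \<or> size X' = 0"
  proof (cases "size X'")
    case (Suc m)
    have "0 \<le> int m * (z - 1)" using zb by simp
    then show ?thesis by (simp add: Suc algebra_simps)
  qed simp
  ultimately have "int (size X') + z \<le> N + 1" using zb by auto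
  then show ?thesis using X le ne that[of X] by (simp add: X')
qed

text \<open>The elements of \<open>U\<close> other than \<open>1\<close> are read as negative integers \<open>- z\<close>.\<close>
lemma exchange_structure:
  assumes W: "\<forall>t\<in>#W. 1 \<le> t" "\<Sum>\<^sub># W < int n" "n < 2 * size W"
    and U: "set_mset U \<subseteq> {1..<int n}" "int n dvd \<Sum>\<^sub># U" "size U < n"
    and max: "\<And>V. V \<subseteq># W + U \<Longrightarrow> int n dvd \<Sum>\<^sub># V \<Longrightarrow> size V \<le> size U"
  obtains c Z where "U = replicate_mset c 1 + image_mset (\<lambda>z. int n - z) Z"
    "\<forall>z\<in>#Z. 1 \<le> z" "\<Sum>\<^sub># Z = int c" "\<Sum>\<^sub># W + int c < int n"
proof -
  define s where "s = \<Sum>\<^sub># W"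
  \<comment> \<open>\<open>N\<close> is the room that \<open>W\<close> leaves below
    \<open>n\<close>: a residue above \<open>s\<close> is the negative of an integer of at most
    \<open>N\<close>.\<close>
  define N where "N = int n - 1 - s"
  have s2: "\<Sum>\<^sub># W + 2 \<le> 2 * int (size W)" using W by linarith
  have sW: "int (size W) \<le> s" unfolding s_def by (rule size_le_sum_mset) fact
  \<comment> \<open>Replacing \<open>Y\<close> by \<open>V\<close> inside \<open>U\<close> gives
    another zero-sum, so maximality of \<open>U\<close> forbids \<open>V\<close> to be
    longer.\<close>
  have exch: "size V \<le> size Y" if "Y \<subseteq># U" "V \<subseteq># W" "int n dvd \<Sum>\<^sub># V - \<Sum>\<^sub># Y" for V Y
  proof -
    have "V + (U - Y) \<subseteq># W + U" using that by (intro subset_mset.add_mono) auto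
    moreover have "\<Sum>\<^sub># (V + (U - Y)) = \<Sum>\<^sub># U + (\<Sum>\<^sub># V - \<Sum>\<^sub># Y)"
      unfolding sum_mset.union sum_mset_diff[OF that(1)] by simp
    ultimately have "size (V + (U - Y)) \<le> size U" using max[of "V + (U - Y)"] dvd_add[OF U(2) that(3)] by metis
    moreover have "size Y \<le> size U" using that(1) by (rule size_mset_mono)
    ultimately show ?thesis unfolding size_union size_Diff_submset[OF that(1)] by linarith
  qed
  \<comment> \<open>A term of \<open>U\<close> in \<open>{2..s}\<close> could be exchanged for at
    least two terms of \<open>W\<close>.\<close>
  have big: "s < y" if y: "y \<in># U" "y \<noteq> 1" for y
  proof (rule ccontr)
    assume "\<not> s < y"
    moreover have "2 \<le> y" using U(1) y by fastforce
    ultimately obtain V where "V \<subseteq># W" "\<Sum>\<^sub># V = y" "2 \<le> size V"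
      using long_subsum[OF W(1) s2, of y] by (auto simp: s_def)
    then show False using exch[of "{#y#}" V] y by simp
  qed
  define c where "c = count U 1"
  define Z where "Z = image_mset (\<lambda>y. int n - y) (filter_mset (\<lambda>y. y \<noteq> 1) U)"
  have Ueq: "U = replicate_mset c 1 + image_mset (\<lambda>z. int n - z) Z"
    using multiset_partition[of U "\<lambda>t. t = 1"]
    by (simp add: c_def Z_def filter_eq_replicate_mset image_mset.compositionality o_def)
  have Z: "\<forall>z\<in>#Z. 1 \<le> z \<and> z \<le> N"
    using big U(1) by (force simp: Z_def N_def)
  have sumim: "\<Sum>\<^sub># (image_mset (\<lambda>z. int n - z) X) = int n * int (size X) - \<Sum>\<^sub># X" for X
    by (induction X) (auto simp: algebra_simps)
  \<comment> \<open>If \<open>Z\<close> overflows, the terms of \<open>U\<close> belonging to a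
    minimal overflow \<open>X\<close> have residue \<open>n - \<Sum>\<^sub># X\<close>, the sum of
    some part \<open>V\<close> of \<open>W\<close>. Since \<open>W - V\<close> has at most as many
    terms as its sum, \<open>V\<close> is long; the exchange bound then yields
    \<open>size W + s \<le> n\<close>, impossible as \<open>n < 2 * size W\<close> and
    \<open>size W \<le> s\<close>.\<close>
  have sumZ: "\<Sum>\<^sub># Z \<le> N"
  proof (rule ccontr)
    assume "\<not> \<Sum>\<^sub># Z \<le> N"
    then obtain X where X: "X \<subseteq># Z" "N < \<Sum>\<^sub># X" "int (size X) + \<Sum>\<^sub># X \<le> 2 * N + 2" "X \<noteq> {#}"
      using minimal_overflow[of N Z] Z W(2) by (auto simp: N_def s_def)
    have "1 \<le> size X" using X(4) by (simp add: Suc_leI nonempty_has_size)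
    then have "0 \<le> int n - \<Sum>\<^sub># X" "int n - \<Sum>\<^sub># X \<le> s" using X sW W(3) by (auto simp: N_def)
    then obtain V where V: "V \<subseteq># W" "\<Sum>\<^sub># V = int n - \<Sum>\<^sub># X"
      using all_subsums[OF W(1) s2, of "int n - \<Sum>\<^sub># X"] by (auto simp: s_def)
    have "int (size (W - V)) \<le> \<Sum>\<^sub># (W - V)"
      using W(1) by (intro size_le_sum_mset) (auto dest: in_diffD)
    then have "int (size W) - int (size V) \<le> s - \<Sum>\<^sub># V"
      using V(1) size_mset_mono[OF V(1)] by (simp add: s_def sum_mset_diff size_Diff_submset of_nat_diff)
    moreover have "size V \<le> size (image_mset (\<lambda>z. int n - z) X)"
    proof (rule exch)
      have "image_mset (\<lambda>z. int n - z) X \<subseteq># image_mset (\<lambda>z. int n - z) Z"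
        using X(1) by (rule image_mset_subseteq_mono)
      then show "image_mset (\<lambda>z. int n - z) X \<subseteq># U"
        unfolding Ueq by (rule subset_mset.order_trans) simp
      show "int n dvd \<Sum>\<^sub># V - \<Sum>\<^sub># (image_mset (\<lambda>z. int n - z) X)"
        by (simp add: sumim V(2))
    qed (fact V(1))
    ultimately show False using X(3) V(2) sW W(3) by (simp add: N_def)
  qed
  have "\<Sum>\<^sub># U = int c + int n * int (size Z) - \<Sum>\<^sub># Z" by (subst Ueq) (simp add: sumim)
  then have "int c - \<Sum>\<^sub># Z = \<Sum>\<^sub># U - int n * int (size Z)" by simp
  then have dvd: "int n dvd int c - \<Sum>\<^sub># Z" using U(2) by simp
  have "0 \<le> \<Sum>\<^sub># Z" using Z by (intro sum_mset_nonneg_int) auto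
  moreover have "c \<le> size U" by (subst Ueq) simp
  moreover have "0 \<le> s" using sW by linarith
  ultimately have "\<bar>int c - \<Sum>\<^sub># Z\<bar> < int n" using sumZ U(3) by (simp add: N_def)
  then have "int c - \<Sum>\<^sub># Z = 0" using dvd zdvd_not_zless[of "\<bar>int c - \<Sum>\<^sub># Z\<bar>" "int n"] by fastforce
  then show ?thesis using Ueq Z sumZ by (intro that[of c Z]) (auto simp: N_def s_def)
qed

section \<open>The structure of long sequences without zero-sums of length \<open>n\<close>\<close>

definition n_zero_sum_free :: "nat \<Rightarrow> int multiset \<Rightarrow> bool" where
  "n_zero_sum_free n S \<longleftrightarrow> (\<forall>U. U \<subseteq># S \<and> size U = n \<longrightarrow> \<not> int n dvd \<Sum>\<^sub># U)"

lemma subset_image_msetE: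
  assumes "V \<subseteq># image_mset f M"
  obtains V' where "V' \<subseteq># M" "V = image_mset f V'"
proof -
  have "image_mset f M = V + (image_mset f M - V)" using assms by simp
  then obtain B C where "M = B + C" "V = image_mset f B" by (blast dest: image_mset_eq_plusD)
  then show ?thesis using that[of B] by simp
qed

text \<open>A zero-sum \<open>V\<close> of at most \<open>n\<close> terms with
  \<open>size V + h \<ge> n\<close> could be filled up with zeros to length \<open>n\<close>. A
  longer one loses a zero-sum of at most \<open>h\<close> terms, which leaves more than
  \<open>n - h\<close> terms, against the induction hypothesis.\<close>

lemma zero_sum_length_bound:
  assumes n: "n > 0" and T: "set_mset T \<subseteq> {1..<int n}" "\<And>x. count T x \<le> h"
    and free: "n_zero_sum_free n (replicate_mset h 0 + T)"
  shows "V \<subseteq># T \<Longrightarrow> int n dvd \<Sum>\<^sub># V \<Longrightarrow> size V + h < n"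
proof (induction "size V" arbitrary: V rule: less_induct)
  case less
  note V = less.prems(1) and dvd = less.prems(2)
  show ?case
  proof (cases "size V \<le> n")
    case True
    show ?thesis
    proof (rule ccontr)
      assume "\<not> size V + h < n"
      then have "replicate_mset (n - size V) 0 + V \<subseteq># replicate_mset h 0 + T"
        using V by (intro subset_mset.add_mono) (auto simp: replicate_mset_msubseteq_iff)
      then have "\<not> int n dvd \<Sum>\<^sub># (replicate_mset (n - size V) 0 + V)"
        using free True unfolding n_zero_sum_free_def
        by (metis le_add_diff_inverse2 size_replicate_mset size_union)
      then show False using dvd by simp
    qed
  next
    case False
    have "set_mset V \<subseteq> {1..<int n}" using T(1) set_mset_mono[OF V] by blast
    moreover have "count V x \<le> h" for x
      using T(2)[of x] mset_subset_eq_count[OF V, of x] by linarith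
    ultimately obtain Y where Y: "Y \<subseteq># V" "Y \<noteq> {#}" "size Y \<le> h" "int n dvd \<Sum>\<^sub># Y"
      using short_zero_sum[OF n, of V h] False by auto
    have sz: "size (V - Y) = size V - size Y" "size Y \<le> size V" "0 < size Y"
      using Y by (auto simp: size_Diff_submset size_mset_mono nonempty_has_size)
    have "V - Y \<subseteq># T" using V by (rule subset_mset.order_trans[rotated]) simp
    moreover have "int n dvd \<Sum>\<^sub># (V - Y)"
      unfolding sum_mset_diff[OF Y(1)] using dvd Y(4) by (rule dvd_diff)
    ultimately have "size (V - Y) + h < n" using less.hyps[of "V - Y"] sz by simp
    then show ?thesis using Y(3) sz False by simp
  qed
qed

text \<open>\<open>U\<close> is a longest zero-sum among the nonzero terms; a zero-sum inside the
  rest \<open>W\<close> could be joined to it.\<close>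

lemma n_zero_sum_free_decomposition:
  assumes n: "n > 0" and S: "set_mset S \<subseteq> {0..<int n}" and cnt: "\<And>x. count S x \<le> count S 0"
    and free: "n_zero_sum_free n S"
  obtains h W U where "S = replicate_mset h 0 + (W + U)" "set_mset (W + U) \<subseteq> {1..<int n}"
    "zero_sum_free n W" "int n dvd \<Sum>\<^sub># U" "size U + h < n"
    "\<And>V. V \<subseteq># W + U \<Longrightarrow> int n dvd \<Sum>\<^sub># V \<Longrightarrow> size V \<le> size U"
proof -
  define h where "h = count S 0"
  define T where "T = filter_mset (\<lambda>x. x \<noteq> 0) S"
  have ST: "S = replicate_mset h 0 + T"
    using multiset_partition[of S "\<lambda>x. x = 0"] by (simp add: h_def T_def filter_eq_replicate_mset)
  have T: "set_mset T \<subseteq> {1..<int n}" using S by (force simp: T_def)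
  have bound: "size V + h < n" if "V \<subseteq># T" "int n dvd \<Sum>\<^sub># V" for V
  proof (rule zero_sum_length_bound[OF n T])
    show "count T x \<le> h" for x using cnt[of x] by (simp add: T_def h_def)
    show "n_zero_sum_free n (replicate_mset h 0 + T)" using free ST by simp
  qed (use that in auto)
  have "\<exists>U. (U \<subseteq># T \<and> int n dvd \<Sum>\<^sub># U) \<and> (\<forall>V. V \<subseteq># T \<and> int n dvd \<Sum>\<^sub># V \<longrightarrow> size V \<le> size U)"
    using bound by (intro ex_has_greatest_nat[of _ "{#}" _ n]) force+
  then obtain U where U: "U \<subseteq># T" "int n dvd \<Sum>\<^sub># U"
    and max: "\<And>V. V \<subseteq># T \<Longrightarrow> int n dvd \<Sum>\<^sub># V \<Longrightarrow> size V \<le> size U" by blast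
  have WU: "T - U + U = T" using U by simp
  have "zero_sum_free n (T - U)"
    unfolding zero_sum_free_def
  proof (intro allI impI notI)
    fix V assume V: "V \<subseteq># T - U \<and> V \<noteq> {#}" and dvd: "int n dvd \<Sum>\<^sub># V"
    have "V + U \<subseteq># T - U + U" using V by simp
    then have "size (V + U) \<le> size U" using U(2) dvd WU by (intro max) auto
    then show False using V by simp
  qed
  then show ?thesis using U bound[OF U] max T ST WU by (intro that[of h "T - U" U]) auto
qed

section \<open>Affine changes of residues\<close>

lemma sum_affine_image:
  "int n dvd \<Sum>\<^sub># (image_mset (\<lambda>x. (u * (x - a)) mod int n) V) - u * (\<Sum>\<^sub># V - a * int (size V))"
proof (induction V)
  case (add x V)
  have "int n dvd - (u * (x - a) - u * (x - a) mod int n)" by (simp only: dvd_minus_iff dvd_minus_mod)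
  then have "int n dvd (\<Sum>\<^sub># (image_mset (\<lambda>x. (u * (x - a)) mod int n) V) - u * (\<Sum>\<^sub># V - a * int (size V)))
    + - (u * (x - a) - u * (x - a) mod int n)" by (rule dvd_add[OF add.IH])
  then show ?case by (simp add: algebra_simps)
qed simp

text \<open>For \<open>n\<close> terms the translation part \<open>a * n\<close> vanishes modulo
  \<open>n\<close>, so zero-sums of length \<open>n\<close> survive every affine bijection; for
  \<open>a = 0\<close> zero-sums of all lengths do.\<close>

lemma affine_image_dvd_iff:
  assumes "coprime u (int n)"
  shows "int n dvd \<Sum>\<^sub># (image_mset (\<lambda>x. (u * (x - a)) mod int n) V) \<longleftrightarrow>
    int n dvd \<Sum>\<^sub># V - a * int (size V)"
proof -
  have "int n dvd \<Sum>\<^sub># (image_mset (\<lambda>x. (u * (x - a)) mod int n) V) \<longleftrightarrow>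
    int n dvd u * (\<Sum>\<^sub># V - a * int (size V))"
    using sum_affine_image[of n u a V] by (metis dvd_diff_right_iff dvd_diff_left_iff)
  also have "\<dots> \<longleftrightarrow> int n dvd \<Sum>\<^sub># V - a * int (size V)"
    using assms by (simp add: coprime_dvd_mult_right_iff coprime_commute)
  finally show ?thesis .
qed

lemma inj_on_affine:
  assumes "coprime u (int n)"
  shows "inj_on (\<lambda>x. (u * (x - a)) mod int n) {0..<int n}"
proof (rule inj_onI)
  fix x y assume xy: "x \<in> {0..<int n}" "y \<in> {0..<int n}"
    and eq: "(u * (x - a)) mod int n = (u * (y - a)) mod int n"
  have "int n dvd u * (x - y)" using eq by (simp add: mod_eq_dvd_iff algebra_simps)
  then have "int n dvd x - y" using assms by (simp add: coprime_dvd_mult_right_iff coprime_commute)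
  then have "x mod int n = y mod int n" by (simp add: mod_eq_dvd_iff)
  then show "x = y" using xy by simp
qed

text \<open>\<open>W\<close> has more than \<open>n / 2\<close> terms and at most \<open>n\<close>
  subsums, so its terms are multiples \<open>g * t\<close> with the \<open>t\<close> of small sum,
  and \<open>u\<close> is the inverse of \<open>g\<close>. The map is written with
  \<open>x - 0\<close> to be an instance of the affine maps.\<close>

lemma zero_sum_free_normal_form:
  assumes n: "n > 0" and W: "set_mset W \<subseteq> {0..<int n}" "zero_sum_free n W" "n < 2 * size W"
  obtains u where "coprime u (int n)"
    "\<forall>t\<in>#image_mset (\<lambda>x. (u * (x - 0)) mod int n) W. 1 \<le> t"
    "\<Sum>\<^sub># (image_mset (\<lambda>x. (u * (x - 0)) mod int n) W) < int n"
proof -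
  have "card (subsums n W) \<le> card {0..<int n}" using subsums_bounds[OF n] by (intro card_mono) auto
  then have "card (subsums n W) < 2 * size W" using W(3) by simp
  then obtain g T where T: "\<forall>t\<in>#T. 1 \<le> t" "W = image_mset (\<lambda>t. g * t mod int n) T"
    and nz: "\<forall>i\<in>{1..\<Sum>\<^sub># T}. \<not> int n dvd g * i"
    using zero_sum_free_structure[OF n W(1,2)] by blast
  have sz: "int (size W) \<le> \<Sum>\<^sub># T" using size_le_sum_mset[OF T(1)] T(2) by simp
  have lt: "\<Sum>\<^sub># T < int n" using nz[rule_format, of "int n"] n by force
  \<comment> \<open>A common divisor \<open>d \<ge> 2\<close> would make
    \<open>g * (n div d)\<close> divisible by \<open>n\<close>, although
    \<open>n div d \<le> n / 2\<close> lies in the range excluded by \<open>nz\<close>.\<close>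
  have "coprime g (int n)"
  proof (rule ccontr)
    assume nc: "\<not> coprime g (int n)"
    define d where "d = gcd g (int n)"
    have "d > 0" using n by (simp add: d_def)
    moreover have "d \<noteq> 1" using nc by (simp add: d_def coprime_iff_gcd_eq_1)
    ultimately have d2: "2 \<le> d" by simp
    obtain i where i: "int n = d * i" unfolding d_def by (meson dvdE gcd_dvd2)
    obtain j where j: "g = d * j" unfolding d_def by (meson dvdE gcd_dvd1)
    have "0 < i" using i n \<open>d > 0\<close> by (metis of_nat_0_less_iff zero_less_mult_pos)
    moreover have "2 * i \<le> int n" using d2 \<open>0 < i\<close> by (simp add: i)
    ultimately have "\<not> int n dvd g * i" using nz sz W(3) by auto
    then show False by (simp add: i j)
  qed
  then obtain u where u: "[g * u = 1] (mod int n)" using cong_solve_coprime_int by blast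
  then have "[u * g = 1] (mod int n)" by (simp add: mult.commute)
  then have cop: "coprime u (int n)" using coprime_iff_invertible_int by blast
  have tle: "t \<le> \<Sum>\<^sub># T" if t: "t \<in># T" for t
  proof -
    obtain T' where "T = add_mset t T'" using multi_member_split[OF t] by blast
    then show ?thesis using T(1) sum_mset_nonneg_int[of T'] by force
  qed
  have "(u * (g * t mod int n - 0)) mod int n = t" if "t \<in># T" for t
  proof -
    have "[(g * u) * t = 1 * t] (mod int n)" using u by (rule cong_scalar_right)
    then have "(g * u * t) mod int n = t" using tle[OF that] lt T(1) that by (force simp: cong_def)
    then show ?thesis by (simp add: mod_simps mult_ac)
  qed
  then have img: "image_mset (\<lambda>x. (u * (x - 0)) mod int n) W = T"
    unfolding T(2) image_mset.compositionality o_def by (metis (no_types, lifting) multiset.map_cong multiset.map_ident)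
  show ?thesis by (rule that[OF cop]) (use T(1) lt in \<open>simp_all only: img\<close>)
qed

theorem n_zero_sum_free_structure:
  assumes n: "n > 0" and S: "set_mset S \<subseteq> {0..<int n}" and free: "n_zero_sum_free n S"
    and long: "3 * n \<le> 2 * size S + 1"
  obtains A B f where "inj_on f (set_mset S)"
    "image_mset f S = A + image_mset (\<lambda>b. (1 - b) mod int n) B"
    "\<forall>a\<in>#A. 1 \<le> a" "\<forall>b\<in>#B. 1 \<le> b" "\<Sum>\<^sub># A < int n" "\<Sum>\<^sub># B < int n"
proof -
  let ?N = "int n"
  have "S \<noteq> {#}" using long n by auto
  then obtain a0 where "a0 \<in># S" by blast
  then have "\<exists>a. a \<in># S \<and> (\<forall>x. x \<in># S \<longrightarrow> count S x \<le> count S a)"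
    by (rule ex_has_greatest_nat[of _ _ _ "Suc (size S)"]) (simp add: count_le_size le_imp_less_Suc)
  then obtain a where a: "a \<in># S" and amax: "\<And>x. x \<in># S \<Longrightarrow> count S x \<le> count S a"
    by blast
  define f0 where "f0 = (\<lambda>x. (1 * (x - a)) mod ?N)"
  have inj0: "inj_on f0 {0..<?N}" unfolding f0_def by (rule inj_on_affine) simp
  define S1 where "S1 = image_mset f0 S"
  have S1: "set_mset S1 \<subseteq> {0..<?N}" using n by (auto simp: S1_def f0_def)
  have count1: "count S1 (f0 y) = count S y" if "y \<in># S" for y
  proof -
    have "{x. x \<in># S \<and> f0 y = f0 x} = {y}" using inj0 S that by (auto dest: inj_onD)
    then show ?thesis by (simp add: S1_def count_image_mset')
  qed
  have cnt1: "count S1 x \<le> count S1 0" for x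
  proof (cases "x \<in># S1")
    case True
    then obtain y where y: "y \<in># S" "x = f0 y" by (auto simp: S1_def)
    have "f0 a = 0" by (simp add: f0_def)
    then show ?thesis using count1[OF y(1)] count1[OF a] amax[OF y(1)] y by simp
  qed (simp add: not_in_iff)
  have free1: "n_zero_sum_free n S1"
    unfolding n_zero_sum_free_def
  proof (intro allI impI notI)
    fix U1 assume U1: "U1 \<subseteq># S1 \<and> size U1 = n" and dvd: "?N dvd \<Sum>\<^sub># U1"
    then obtain U where U: "U \<subseteq># S" "U1 = image_mset f0 U" unfolding S1_def by (metis subset_image_msetE)
    then have "?N dvd \<Sum>\<^sub># U - a * int (size U)"
      using dvd affine_image_dvd_iff[of 1 n a U] by (simp add: f0_def)
    moreover have "size U = n" using U U1 by simp
    ultimately have "?N dvd \<Sum>\<^sub># U" by (metis dvd_diff_left_iff dvd_triv_right)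
    then show False using free U \<open>size U = n\<close> unfolding n_zero_sum_free_def by blast
  qed
  obtain h W U where dec: "S1 = replicate_mset h 0 + (W + U)" "set_mset (W + U) \<subseteq> {1..<?N}"
    "zero_sum_free n W" "?N dvd \<Sum>\<^sub># U" "size U + h < n"
    and max: "\<And>V. V \<subseteq># W + U \<Longrightarrow> ?N dvd \<Sum>\<^sub># V \<Longrightarrow> size V \<le> size U"
    using n_zero_sum_free_decomposition[OF n S1 cnt1 free1] by metis
  have "size S = h + (size W + size U)" using arg_cong[OF dec(1), of size] by (simp add: S1_def)
  \<comment> \<open>As \<open>h + size U \<le> n - 1\<close>, the assumed length leaves more than
    \<open>n / 2\<close> terms for \<open>W\<close>.\<close>
  then have szW: "n < 2 * size W" using long dec(5) by linarith
  have Wr: "set_mset W \<subseteq> {0..<?N}" using dec(2) by force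
  obtain u where u: "coprime u ?N"
    "\<forall>t\<in>#image_mset (\<lambda>x. (u * (x - 0)) mod ?N) W. 1 \<le> t"
    "\<Sum>\<^sub># (image_mset (\<lambda>x. (u * (x - 0)) mod ?N) W) < ?N"
    using zero_sum_free_normal_form[OF n Wr dec(3) szW] by metis
  define f1 where "f1 = (\<lambda>x. (u * (x - 0)) mod ?N)"
  define W' where "W' = image_mset f1 W"
  define U' where "U' = image_mset f1 U"
  have dvd1: "?N dvd \<Sum>\<^sub># (image_mset f1 V) \<longleftrightarrow> ?N dvd \<Sum>\<^sub># V" for V
    using affine_image_dvd_iff[OF u(1), of 0 V] by (simp add: f1_def)
  have U'r: "set_mset U' \<subseteq> {1..<?N}"
  proof
    fix y assume "y \<in># U'"
    then obtain x where x: "x \<in># U" "y = f1 x" by (auto simp: U'_def)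
    then have "x \<in> {1..<?N}" using dec(2) by auto
    then have "\<not> ?N dvd x" using zdvd_not_zless by auto
    then have "\<not> ?N dvd f1 x" using dvd1[of "{#x#}"] by simp
    then have "f1 x \<noteq> 0" by auto
    moreover have "0 \<le> f1 x" "f1 x < ?N" using n by (auto simp: f1_def)
    ultimately show "y \<in> {1..<?N}" using x by auto
  qed
  have max': "size V \<le> size U'" if "V \<subseteq># W' + U'" "?N dvd \<Sum>\<^sub># V" for V
  proof -
    have "V \<subseteq># image_mset f1 (W + U)" using that(1) by (simp add: W'_def U'_def)
    then obtain V' where V': "V' \<subseteq># W + U" "V = image_mset f1 V'" by (rule subset_image_msetE)
    then show ?thesis using max[of V'] that(2) dvd1[of V'] by (simp add: U'_def)
  qed
  obtain c Z where U'eq: "U' = replicate_mset c 1 + image_mset (\<lambda>z. ?N - z) Z"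
    and Z: "\<forall>z\<in>#Z. 1 \<le> z" "\<Sum>\<^sub># Z = int c" "\<Sum>\<^sub># W' + int c < ?N"
  proof (rule exchange_structure[of W' n U'])
    show "\<forall>t\<in>#W'. 1 \<le> t" "\<Sum>\<^sub># W' < ?N" using u by (auto simp: W'_def f1_def)
    show "n < 2 * size W'" "size U' < n" using szW dec(5) by (auto simp: W'_def U'_def)
    show "?N dvd \<Sum>\<^sub># U'" using dvd1 dec(4) by (simp add: U'_def)
  qed (use U'r max' that in auto)
  \<comment> \<open>The ones of \<open>U'\<close> join \<open>W'\<close>. The zeros are
    \<open>1 - 1\<close> and the terms \<open>- z\<close> are \<open>1 - (z + 1)\<close>, so the sum
    of \<open>B\<close> is \<open>h + c + size Z\<close>, which equals
    \<open>h + size U\<close>.\<close>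
  define A where "A = W' + replicate_mset c 1"
  define B where "B = replicate_mset h 1 + image_mset (\<lambda>z. z + 1) Z"
  have "image_mset (\<lambda>b. (1 - b) mod ?N) (image_mset (\<lambda>z. z + 1) Z) = image_mset (\<lambda>z. ?N - z) Z"
    unfolding image_mset.compositionality o_def
  proof (rule image_mset_cong)
    fix z assume z: "z \<in># Z"
    have "?N - z \<in> {1..<?N}" using U'r z by (auto simp: U'eq)
    then have "(- z + ?N) mod ?N = - z + ?N" by (intro mod_pos_pos_trivial) auto
    then have "- z mod ?N = ?N - z" unfolding mod_add_self2 by linarith
    then show "(1 - (z + 1)) mod ?N = ?N - z" by simp
  qed
  then have eq: "image_mset (f1 \<circ> f0) S = A + image_mset (\<lambda>b. (1 - b) mod ?N) B"
    using arg_cong[OF dec(1), of "image_mset f1"] U'eq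
    by (simp add: A_def B_def S1_def W'_def U'_def image_mset.compositionality f1_def)
  have "inj_on f1 (f0 ` set_mset S)"
    unfolding f1_def by (rule inj_on_subset[OF inj_on_affine[OF u(1)]]) (use S1 in \<open>simp add: S1_def\<close>)
  then have inj: "inj_on (f1 \<circ> f0) (set_mset S)"
    using inj_on_subset[OF inj0 S] by (rule comp_inj_on[rotated])
  have "\<Sum>\<^sub># (image_mset (\<lambda>z. z + 1) Z) = \<Sum>\<^sub># Z + int (size Z)"
    by (induction Z) auto
  moreover have "size U = c + size Z" using arg_cong[OF U'eq, of size] by (simp add: U'_def)
  ultimately have "\<Sum>\<^sub># B < ?N" using Z(2) dec(5) by (simp add: B_def)
  moreover have "\<forall>b\<in>#B. 1 \<le> b" using Z(1) by (auto simp: B_def)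
  moreover have "\<forall>a\<in>#A. 1 \<le> a" using u(2) by (auto simp: A_def W'_def f1_def)
  moreover have "\<Sum>\<^sub># A < ?N" using Z(3) by (simp add: A_def)
  ultimately show ?thesis using that[OF inj eq] by blast
qed

section \<open>Counting distinct terms\<close>

text \<open>Induction inserting the largest element, which exceeds the number of smaller
  ones.\<close>

lemma sum_distinct_positive:
  fixes X :: "int set"
  assumes "finite X" "\<forall>x\<in>X. 1 \<le> x"
  shows "int (card X) * (int (card X) + 1) \<le> 2 * \<Sum>X"
  using assms
proof (induction X rule: finite_linorder_max_induct)
  case (insert b X)
  have "X \<subseteq> {1..b - 1}" using insert by force
  then have "card X \<le> card {1..b - 1}" by (intro card_mono) auto
  then have "int (card X) + 1 \<le> b" using insert.prems by (simp add: le_nat_iff)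
  moreover have "b \<notin> X" using insert by blast
  ultimately show ?case using insert by (simp add: algebra_simps)
qed simp

text \<open>One copy of each distinct value contributes at least \<open>p * (p + 1) / 2\<close> in
  total, and each remaining term at least 1.\<close>

lemma sum_mset_distinct_bound:
  fixes A :: "int multiset"
  assumes "\<forall>a\<in>#A. 1 \<le> a"
  defines "p \<equiv> int (card (set_mset A))"
  shows "p * (p - 1) + 2 * int (size A) \<le> 2 * \<Sum>\<^sub># A"
proof -
  define D where "D = mset_set (set_mset A)"
  have D: "D \<subseteq># A" by (simp add: D_def mset_set_set_mset_msubset)
  have "int (size (A - D)) \<le> \<Sum>\<^sub># (A - D)"
    using assms(1) by (intro size_le_sum_mset) (auto dest: in_diffD)
  moreover have "int (size (A - D)) = int (size A) - p"
    using size_mset_mono[OF D] by (simp add: size_Diff_submset[OF D] of_nat_diff) (simp add: D_def p_def)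
  moreover have "\<Sum>\<^sub># (A - D) = \<Sum>\<^sub># A - \<Sum>(set_mset A)"
    by (simp add: sum_mset_diff[OF D]) (simp add: D_def sum_unfold_sum_mset)
  moreover have "p * (p + 1) \<le> 2 * \<Sum>(set_mset A)"
    unfolding p_def using assms(1) by (intro sum_distinct_positive) auto
  ultimately show ?thesis by (simp add: algebra_simps)
qed

text \<open>Both sums in the structure theorem are at most \<open>n - 1\<close>; the
  \<open>p\<close> distinct \<open>a\<close> and \<open>q\<close> distinct \<open>b\<close>, with
  \<open>p + q \<ge> k\<close>, use up part of them without adding to the length.\<close>

lemma n_zero_sum_free_length_bound:
  assumes n: "n > 0" and S: "set_mset S \<subseteq> {0..<int n}" and free: "n_zero_sum_free n S"
    and long: "3 * n \<le> 2 * size S + 1" and k: "1 \<le> k" "k \<le> card (set_mset S)"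
  shows "size S + (k - 1)\<^sup>2 div 4 + 2 \<le> 2 * n"
proof -
  obtain A B f where inj: "inj_on f (set_mset S)"
    and eq: "image_mset f S = A + image_mset (\<lambda>b. (1 - b) mod int n) B"
    and pos: "\<forall>a\<in>#A. 1 \<le> a" "\<forall>b\<in>#B. 1 \<le> b" and sums: "\<Sum>\<^sub># A < int n" "\<Sum>\<^sub># B < int n"
    using n_zero_sum_free_structure[OF n S free long] by metis
  define p where "p = int (card (set_mset A))"
  define q where "q = int (card (set_mset B))"
  define e where "e = int k"
  have "card (set_mset S) = card (set_mset (image_mset f S))" using inj by (simp add: card_image)
  also have "\<dots> \<le> card (set_mset A) + card ((\<lambda>b. (1 - b) mod int n) ` set_mset B)"
    unfolding eq by (simp add: card_Un_le)
  also have "\<dots> \<le> card (set_mset A) + card (set_mset B)" by (simp add: card_image_le)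
  finally have e: "1 \<le> e" "e \<le> p + q" using k by (simp_all add: e_def p_def q_def)
  have "size S = size A + size B" using arg_cong[OF eq, of size] by simp
  then have sz: "p * (p - 1) + q * (q - 1) + 2 * int (size S) \<le> 4 * int n - 4"
    using sum_mset_distinct_bound[OF pos(1)] sum_mset_distinct_bound[OF pos(2)] sums
    by (simp add: p_def q_def)
  \<comment> \<open>The square \<open>(p - q)\<^sup>2\<close> in the following identity measures the
    imbalance: for fixed \<open>p + q\<close> the loss of length is least when \<open>p\<close> and
    \<open>q\<close> are closest.\<close>
  have "(e - 1)\<^sup>2 \<le> (p + q - 1)\<^sup>2" using e by (intro power_mono) auto
  also have "\<dots> = 2 * (p * (p - 1) + q * (q - 1)) + 1 - (p - q)\<^sup>2"
    by (simp add: power2_eq_square algebra_simps)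
  also have "\<dots> \<le> 2 * (p * (p - 1) + q * (q - 1)) + 1" by simp
  finally have "(e - 1)\<^sup>2 \<le> 2 * (p * (p - 1) + q * (q - 1)) + 1" .
  moreover have "int ((k - 1)\<^sup>2) = (e - 1)\<^sup>2" using k(1) by (simp add: e_def of_nat_diff)
  moreover have "4 * ((k - 1)\<^sup>2 div 4) \<le> (k - 1)\<^sup>2" by simp
  ultimately have "4 * int ((k - 1)\<^sup>2 div 4) \<le> 2 * (p * (p - 1) + q * (q - 1)) + 1" by linarith
  \<comment> \<open>The left side and the doubled term are even, so the summand 1 drops out before
    halving.\<close>
  then have "2 * int ((k - 1)\<^sup>2 div 4) \<le> p * (p - 1) + q * (q - 1)" by presburger
  then have "int (size S + (k - 1)\<^sup>2 div 4 + 2) \<le> int (2 * n)" using sz unfolding of_nat_add by simp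
  then show ?thesis by (simp only: of_nat_le_iff)
qed

section \<open>Sharpness of the structure theorem\<close>

text \<open>The sum of \<open>n\<close> terms lifts to an integer, the sum of \<open>A'\<close> plus
  \<open>size B'\<close> minus the sum of \<open>B'\<close>. Positive integers sum to at least their
  number, so it is at least \<open>n\<close> minus the sum of \<open>B'\<close> and at most the sum
  of \<open>A'\<close>, hence strictly between 0 and \<open>n\<close>.\<close>

lemma n_zero_sum_free_of_small_sums:
  assumes pos: "\<forall>a\<in>#A. 1 \<le> a" "\<forall>b\<in>#B. 1 \<le> b" and sums: "\<Sum>\<^sub># A < int n" "\<Sum>\<^sub># B < int n"
  shows "n_zero_sum_free n (A + image_mset (\<lambda>b. (1 - b) mod int n) B)"
  unfolding n_zero_sum_free_def
proof (intro allI impI notI)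
  let ?f = "\<lambda>b. (1 - b) mod int n"
  fix U assume U: "U \<subseteq># A + image_mset ?f B \<and> size U = n" and dvd: "int n dvd \<Sum>\<^sub># U"
  have "U - A \<subseteq># image_mset ?f B" using U by (simp add: subset_eq_diff_conv add.commute)
  then obtain B' where B': "B' \<subseteq># B" "U - A = image_mset ?f B'" by (rule subset_image_msetE)
  define A' where "A' = U \<inter># A"
  have Ueq: "U = A' + image_mset ?f B'"
    unfolding A'_def B'(2)[symmetric] by (simp add: multiset_eq_iff min_def)
  have le: "int (size C') \<le> \<Sum>\<^sub># C' \<and> \<Sum>\<^sub># C' \<le> \<Sum>\<^sub># C"
    if "C' \<subseteq># C" "\<forall>c\<in>#C. 1 \<le> c" for C C' :: "int multiset"
  proof
    show "int (size C') \<le> \<Sum>\<^sub># C'" using that by (intro size_le_sum_mset) (auto dest: mset_subset_eqD)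
    have "0 \<le> \<Sum>\<^sub># (C - C')" using that(2) by (intro sum_mset_nonneg_int) (force dest: in_diffD)
    then show "\<Sum>\<^sub># C' \<le> \<Sum>\<^sub># C" by (simp add: sum_mset_diff[OF that(1)])
  qed
  have A': "int (size A') \<le> \<Sum>\<^sub># A'" "\<Sum>\<^sub># A' \<le> \<Sum>\<^sub># A"
    using le[of A' A] pos(1) by (simp_all add: A'_def)
  have "int (size B') \<le> \<Sum>\<^sub># B'" "\<Sum>\<^sub># B' \<le> \<Sum>\<^sub># B" using le[OF B'(1) pos(2)] by auto
  moreover have "size A' + size B' = n" using U Ueq by (metis size_image_mset size_union)
  ultimately have range: "1 \<le> \<Sum>\<^sub># A' + (int (size B') - \<Sum>\<^sub># B')"
      "\<Sum>\<^sub># A' + (int (size B') - \<Sum>\<^sub># B') < int n"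
    using A' sums by linarith+
  \<comment> \<open>The map \<open>1 - b\<close> is affine, with factor -1 applied to
    \<open>b - 1\<close>.\<close>
  have "int n dvd \<Sum>\<^sub># (image_mset ?f B') - (int (size B') - \<Sum>\<^sub># B')"
    using sum_affine_image[of n "-1" 1 B'] by simp
  then have "int n dvd \<Sum>\<^sub># U - (\<Sum>\<^sub># (image_mset ?f B') - (int (size B') - \<Sum>\<^sub># B'))"
    by (rule dvd_diff[OF dvd])
  then have "int n dvd \<Sum>\<^sub># A' + (int (size B') - \<Sum>\<^sub># B')"
    by (simp add: Ueq)
  then show False using range zdvd_not_zless by force
qed

section \<open>Sublists and submultisets\<close>

lemma subset_mset_imp_subseq:
  assumes "U \<subseteq># mset xs"
  obtains ys where "subseq ys xs" "mset ys = U"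
proof -
  have "\<exists>ys. subseq ys xs \<and> mset ys = U"
    using assms
  proof (induction xs arbitrary: U)
    case (Cons x xs)
    from Cons.prems have "U \<subseteq># add_mset x (mset xs)" by simp
    then show ?case
    proof (cases rule: subset_add_mset_cases)
      case 1
      then show ?thesis using Cons.IH by blast
    next
      case (2 V)
      then obtain ys where "subseq ys xs" "mset ys = V" using Cons.IH by blast
      then show ?thesis using 2 by (intro exI[of _ "x # ys"]) simp
    qed
  qed simp
  then show ?thesis using that by blast
qed

lemma subseq_imp_subset_mset: "subseq ys xs \<Longrightarrow> mset ys \<subseteq># mset xs"
  by (induction rule: list_emb.induct) (auto intro: subset_mset.order_trans)

lemma has_zero_sum_subseq_iff: "has_zero_sum_subseq n xs \<longleftrightarrow> \<not> n_zero_sum_free n (mset xs)"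
proof
  assume "has_zero_sum_subseq n xs"
  then obtain ys where "subseq ys xs" "length ys = n" "int n dvd sum_list ys"
    by (auto simp: has_zero_sum_subseq_def cong_0_iff)
  then show "\<not> n_zero_sum_free n (mset xs)"
    unfolding n_zero_sum_free_def using subseq_imp_subset_mset[of ys xs]
    by (metis size_mset sum_mset_sum_list)
next
  assume "\<not> n_zero_sum_free n (mset xs)"
  then obtain U where U: "U \<subseteq># mset xs" "size U = n" "int n dvd \<Sum>\<^sub># U"
    by (auto simp: n_zero_sum_free_def)
  then obtain ys where "subseq ys xs" "mset ys = U" using subset_mset_imp_subseq by blast
  then show "has_zero_sum_subseq n xs"
    using U unfolding has_zero_sum_subseq_def
    by (intro exI[of _ ys]) (auto simp: cong_0_iff sum_mset_sum_list)
qed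

section \<open>Extremal sequences\<close>

text \<open>\<open>p\<close> and \<open>q\<close> are the halves of \<open>k\<close>, and
  \<open>x\<close> and \<open>y\<close> count the additional ones that bring the sums
  \<open>1 + ... + p\<close> and \<open>1 + ... + q\<close> up to exactly \<open>n - 1\<close>. The
  bounds on \<open>k\<close> leave room for this.\<close>

lemma extremal_parameters:
  fixes k n :: nat
  assumes k: "4 \<le> k" and n: "(k - 1)\<^sup>2 + 1 \<le> 2 * n"
  obtains p q x y where "p + q = k" "p * (p + 1) + 2 * x = 2 * (n - 1)"
    "q * (q + 1) + 2 * y = 2 * (n - 1)" "k + x + y + (k - 1)\<^sup>2 div 4 = 2 * n - 2"
proof -
  have fill: "\<exists>x. p * (p + 1) + 2 * x = 2 * (n - 1)" if "p * (p + 1) \<le> 2 * (n - 1)" for p :: nat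
  proof -
    have "even (2 * (n - 1) - p * (p + 1))" by simp
    then show ?thesis using that by (metis evenE le_add_diff_inverse)
  qed
  define j where "j = k div 2"
  have j: "2 \<le> j" using k by (simp add: j_def)
  \<comment> \<open>Writing \<open>k\<close> as \<open>2 * i + 4\<close> or \<open>2 * i + 5\<close>
    removes the truncated subtraction from \<open>(k - 1)\<^sup>2\<close>.\<close>
  then obtain i where i: "j = i + 2" by (metis le_add_diff_inverse2)
  show ?thesis
  proof (cases "even k")
    case True
    then have "k = 2 * j" by (simp add: j_def)
    then have kj: "k = 2 * i + 4" using i by simp
    have sq: "(k - 1)\<^sup>2 = 4 * (i * i + 3 * i + 2) + 1" by (simp add: kj power2_eq_square algebra_simps)
    have div: "(k - 1)\<^sup>2 div 4 = i * i + 3 * i + 2" unfolding sq by simp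
    have "2 * (i * i + 3 * i + 2) + 1 \<le> n" using n sq by linarith
    then have "j * (j + 1) \<le> 2 * (n - 1)" by (simp add: i algebra_simps)
    then obtain x where x: "j * (j + 1) + 2 * x = 2 * (n - 1)" using fill by blast
    show ?thesis using x div by (intro that[of j j x x]) (auto simp: kj i algebra_simps)
  next
    case False
    then have "k = 2 * j + 1" by (simp add: j_def)
    then have kj: "k = 2 * i + 5" using i by simp
    have sq: "(k - 1)\<^sup>2 = 4 * (i * i + 4 * i + 4)" by (simp add: kj power2_eq_square algebra_simps)
    have div: "(k - 1)\<^sup>2 div 4 = i * i + 4 * i + 4" unfolding sq by simp
    have "2 * (i * i + 4 * i + 4) + 1 \<le> n" using n sq by linarith
    then have "j * (j + 1) \<le> 2 * (n - 1)" "(j + 1) * (j + 1 + 1) \<le> 2 * (n - 1)"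
      by (simp_all add: i algebra_simps)
    then obtain x y where x: "(j + 1) * (j + 1 + 1) + 2 * x = 2 * (n - 1)"
      and y: "j * (j + 1) + 2 * y = 2 * (n - 1)" using fill by metis
    show ?thesis using x y div by (intro that[of "j + 1" j x y]) (auto simp: kj i algebra_simps)
  qed
qed

lemma sum_first_integers: "2 * sum_list (map int [1..<Suc p]) = int (p * (p + 1))"
  by (induction p) (auto simp: algebra_simps)

text \<open>The longest example has the terms \<open>1, ..., p\<close> and
  \<open>1 - 1, ..., 1 - q\<close>, padded with ones and zeros. Its \<open>k\<close> distinct terms
  come first, so cutting it to any length \<open>m \<ge> k\<close> keeps them, and a part of an
  \<open>n\<close>-zero-free sequence stays \<open>n\<close>-zero-free.\<close>

lemma extremal_sequence:
  assumes k: "4 \<le> k" "k \<le> n" and n: "(k - 1)\<^sup>2 + 1 \<le> 2 * n"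
    and m: "k \<le> m" "m + (k - 1)\<^sup>2 div 4 + 2 \<le> 2 * n"
  obtains xs where "residue_seq n xs" "length xs = m" "k \<le> card (set xs)"
    "n_zero_sum_free n (mset xs)"
proof -
  obtain p q x y where p: "p + q = k" "p * (p + 1) + 2 * x = 2 * (n - 1)"
    and q: "q * (q + 1) + 2 * y = 2 * (n - 1)" "k + x + y + (k - 1)\<^sup>2 div 4 = 2 * n - 2"
    using extremal_parameters[OF k(1) n] by metis
  define f where "f = (\<lambda>b. (1 - b) mod int n)"
  define P where "P = map int [1..<Suc p]"
  define Q where "Q = map int [1..<Suc q]"
  define ds where "ds = P @ map f Q"
  define zs where "zs = ds @ replicate x 1 @ replicate y 0"
  have n4: "4 \<le> n" using k by simp
  have f1: "f 1 = 0" by (simp add: f_def)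
  have fval: "f b = int n + 1 - b" if "2 \<le> b" "b \<le> int n" for b
  proof -
    have "(1 - b + int n) mod int n = 1 - b + int n"
      using that by (intro mod_pos_pos_trivial) auto
    then show ?thesis unfolding f_def mod_add_self2 by linarith
  qed
  have Qset: "set Q = {1..int q}"
    unfolding Q_def set_map set_upt image_int_atLeastLessThan by auto
  have Pset: "set P = {1..int p}"
    unfolding P_def set_map set_upt image_int_atLeastLessThan by auto
  have qn: "int q \<le> int n" "int p + int q \<le> int n" using p(1) k by auto
  have frange: "f b = 0 \<and> b = 1 \<or> f b = int n + 1 - b \<and> 2 \<le> b" if "b \<in> set Q" for b
    using that f1 fval[of b] qn unfolding Qset by (cases "b = 1") auto
  have "inj_on f (set Q)"
  proof (rule inj_onI)
    fix a b assume ab: "a \<in> set Q" "b \<in> set Q" "f a = f b"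
    have "a \<le> int n" "b \<le> int n" using ab qn by (auto simp: Qset)
    then show "a = b" using frange[OF ab(1)] frange[OF ab(2)] ab(3) by auto
  qed
  moreover have "distinct P" "distinct Q" by (auto simp: P_def Q_def distinct_map)
  \<comment> \<open>The value at \<open>b = 1\<close> is 0; for \<open>b \<ge> 2\<close> the
    residues lie above \<open>n - q\<close>, hence above \<open>p\<close>.\<close>
  moreover have "set P \<inter> f ` set Q = {}"
  proof (intro equals0I)
    fix a assume "a \<in> set P \<inter> f ` set Q"
    then obtain b where b: "b \<in> set Q" "a = f b" "1 \<le> a" "a \<le> int p" by (auto simp: Pset)
    then have "a = int n + 1 - b" "b \<le> int q" using frange[OF b(1)] by (auto simp: Qset)
    then show False using b qn by linarith
  qed
  ultimately have dist: "distinct ds" by (simp add: ds_def distinct_map)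
  have lends: "length ds = k" using p(1) by (simp add: ds_def P_def Q_def)
  have lenzs: "length zs = k + x + y" by (simp add: zs_def lends)
  have "2 * p \<le> p * (p + 1)" by (cases p) auto
  then have "p < n" using p(2) n4 by linarith
  then have res: "residue_seq n zs"
    using n4 Pset by (auto simp: residue_seq_def zs_def ds_def f_def)
  define A where "A = mset P + replicate_mset x 1"
  define B where "B = mset Q + replicate_mset y 1"
  have zs: "mset zs = A + image_mset f B"
    by (simp add: zs_def ds_def A_def B_def f1)
  have "2 * \<Sum>\<^sub># A = int (p * (p + 1) + 2 * x)" "2 * \<Sum>\<^sub># B = int (q * (q + 1) + 2 * y)"
    using sum_first_integers[of p] sum_first_integers[of q]
    by (simp_all only: A_def B_def P_def Q_def sum_mset.union sum_mset_sum_list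
        sum_mset_replicate_mset of_nat_add of_nat_mult distrib_left)
  then have "\<Sum>\<^sub># A < int n" "\<Sum>\<^sub># B < int n" unfolding p(2) q(1) using n4 by auto
  moreover have "\<forall>a\<in>#A. 1 \<le> a" "\<forall>b\<in>#B. 1 \<le> b" using Pset Qset by (auto simp: A_def B_def)
  ultimately have free: "n_zero_sum_free n (mset zs)"
    unfolding zs f_def by (intro n_zero_sum_free_of_small_sums)
  have sub: "mset (take m zs) \<subseteq># mset zs"
    by (metis append_take_drop_id mset_append mset_subset_eq_add_left)
  have free': "n_zero_sum_free n (mset (take m zs))"
    using free subset_mset.order_trans[OF _ sub] unfolding n_zero_sum_free_def by blast
  have "set ds \<subseteq> set (take m zs)" using m(1) lends by (simp add: zs_def)
  then have "card (set ds) \<le> card (set (take m zs))" by (intro card_mono) auto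
  then have "k \<le> card (set (take m zs))" using dist lends by (simp add: distinct_card)
  moreover have "residue_seq n (take m zs)"
    using res unfolding residue_seq_def by (meson order_trans set_take_subset)
  moreover have "length (take m zs) = m" using m(2) q(2) lenzs by simp
  ultimately show ?thesis using that free' by blast
qed

theorem theorem3:
  fixes n k :: nat
  assumes "k \<le> n"
    and "4 \<le> k"
    and "real k \<le> sqrt (2 * real n - 1) + 1"
  shows "int (g n k) = 2 * int n - 1 - \<lfloor>((real k - 1) / 2)\<^sup>2\<rfloor>"
proof -
  define F where "F = (k - 1)\<^sup>2 div 4"
  have "(real k - 1)\<^sup>2 \<le> (sqrt (2 * real n - 1))\<^sup>2"
    using assms by (intro power_mono) auto
  also have "\<dots> = 2 * real n - 1" using assms by simp
  finally have "real ((k - 1)\<^sup>2 + 1) \<le> real (2 * n)" using assms(2) by (simp add: of_nat_diff)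
  then have sq: "(k - 1)\<^sup>2 + 1 \<le> 2 * n" by (simp only: of_nat_le_iff)
  \<comment> \<open>Equivalent to \<open>3 * n \<le> 2 * (2 * n - 1 - F) + 1\<close>: the length
    \<open>2 * n - 1 - F\<close> is within reach of the structure theorem.\<close>
  have F: "2 * F + 1 \<le> n" using sq by (simp add: F_def)
  have "((real k - 1) / 2)\<^sup>2 = real ((k - 1)\<^sup>2) / real 4"
    using assms(2) by (simp add: power_divide of_nat_diff)
  then have floor: "\<lfloor>((real k - 1) / 2)\<^sup>2\<rfloor> = int F"
    by (simp only: floor_divide_of_nat_eq F_def)
  have n: "n > 0" using assms by simp
  have "g n k = 2 * n - 1 - F"
    unfolding g_def
  proof (rule Least_equality, intro conjI allI impI)
    show "k \<le> 2 * n - 1 - F" using assms F by simp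
  next
    fix xs assume xs: "residue_seq n xs \<and> length xs = 2 * n - 1 - F \<and> k \<le> card (set xs)"
    show "has_zero_sum_subseq n xs"
    proof (rule ccontr)
      assume "\<not> has_zero_sum_subseq n xs"
      then have free: "n_zero_sum_free n (mset xs)" by (simp add: has_zero_sum_subseq_iff)
      have "size (mset xs) + (k - 1)\<^sup>2 div 4 + 2 \<le> 2 * n"
        using xs F assms(2) by (intro n_zero_sum_free_length_bound[OF n _ free]) (auto simp: residue_seq_def)
      then have "length xs + F + 2 \<le> 2 * n" by (simp only: F_def size_mset)
      moreover have "length xs = 2 * n - 1 - F" using xs by simp
      ultimately show False using F by linarith
    qed
  next
    fix m assume m: "k \<le> m \<and> (\<forall>xs. residue_seq n xs \<and> length xs = m \<and> k \<le> card (set xs)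
        \<longrightarrow> has_zero_sum_subseq n xs)"
    show "2 * n - 1 - F \<le> m"
    proof (rule ccontr)
      assume "\<not> 2 * n - 1 - F \<le> m"
      then have "m + (k - 1)\<^sup>2 div 4 + 2 \<le> 2 * n" by (simp add: F_def)
      then show False
        using extremal_sequence[OF assms(2,1) sq] m by (metis has_zero_sum_subseq_iff)
    qed
  qed
  then show ?thesis using F floor by (simp add: of_nat_diff)
qed

end
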